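(* Let $n\ge 3$ be an integer and let $D_{2n}=\langle x,y\mid x^n=y^2=e,\ xy=yx^{-1}\rangle$ be the dihedral group of order $2n$. If the cyclic subgroup $\langle x\rangle$ of order $n$ is isomorphic to $\mathbb{Z}_{2^k}\times\mathbb{Z}_p$, where $p\ne 2$ is a prime and $k>1$, then $$\dim(\mathcal{D}(D_{2n}))=n-\phi(n)-\tau(n)+2.$$ Otherwise, $$\dim(\mathcal{D}(D_{2n}))=n-\phi(n)-\tau(n)+1.$$
   Context: For a finite group $G$, the power graph $\mathcal{P}(G)$ is the simple graph with vertex set $G$ in which distinct $x,y$ are adjacent iff $x\in\langle y\rangle$ or $y\in\langle x\rangle$. The enhanced power graph $\mathcal{P}_E(G)$ is the simple graph with vertex set $G$ in which distinct $x,y$ are adjacent iff both belong to some common cyclic subgroup of $G$. The difference graph $\mathcal{D}(G)$ is obtained from $\mathcal{P}_E(G)$ by removing all edges of $\mathcal{P}(G)$ and then deleting all isolated vertices. A set $W$ of vertices of a graph is a resolving set if for every pair of distinct vertices $u,v$ there is $z\in W$ with $d(u,z)\ne d(v,z)$, where $d$ is graph distance; the metric dimension $\dim(\Gamma)$ is the minimum size of a resolving set of $\Gamma$. $\phi$ is Euler's totient function and $\tau(n)$ is the number of positive divisors of $n$.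
   Formalization: The formal theorem additionally assumes that the difference graph D(D_{2n}) has at least one vertex, i.e. that n is not a prime power; for prime powers the graph is empty and the stated formula fails in general (n = 9 gives 1, n = 16 gives 4). *)

theory Defs
  imports
    "HOL-Algebra.Elementary_Groups"
    "HOL-Number_Theory.Totient"
    "Graph_Theory.Graph_Theory"
begin

text \<open>
  Simple graphs are symmetric, loop-free pair digraphs: each edge is represented by its two
  opposite arcs (locale \<^locale>\<open>pair_graph\<close>).
\<close>

definition power_graph :: "('a, 'b) monoid_scheme \<Rightarrow> 'a pair_pre_digraph" where
  "power_graph G =
     \<lparr>pverts = carrier G,
      parcs = {(x, y). x \<in> carrier G \<and> y \<in> carrier G \<and> x \<noteq> y \<and>
                       (x \<in> generate G {y} \<or> y \<in> generate G {x})}\<rparr>"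

definition enhanced_power_graph :: "('a, 'b) monoid_scheme \<Rightarrow> 'a pair_pre_digraph" where
  "enhanced_power_graph G =
     \<lparr>pverts = carrier G,
      parcs = {(x, y). x \<in> carrier G \<and> y \<in> carrier G \<and> x \<noteq> y \<and>
                       (\<exists>C. subgroup C G \<and> cyclic_group (G\<lparr>carrier := C\<rparr>) \<and> x \<in> C \<and> y \<in> C)}\<rparr>"

definition delete_isolated :: "'a pair_pre_digraph \<Rightarrow> 'a pair_pre_digraph" where
  "delete_isolated \<Gamma> = \<lparr>pverts = {v \<in> pverts \<Gamma>. \<exists>w. (v, w) \<in> parcs \<Gamma>}, parcs = parcs \<Gamma>\<rparr>"

definition difference_graph :: "('a, 'b) monoid_scheme \<Rightarrow> 'a pair_pre_digraph" where
  "difference_graph G =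
     delete_isolated
       \<lparr>pverts = carrier G,
        parcs = parcs (enhanced_power_graph G) - parcs (power_graph G)\<rparr>"

text \<open>
  The distance is the least length of a walk, i.e. the shortest-path distance for unit arc costs;
  it is \<open>\<infinity>\<close> between different components.
\<close>

definition graph_dist :: "'a pair_pre_digraph \<Rightarrow> 'a \<Rightarrow> 'a \<Rightarrow> ereal" where
  "graph_dist \<Gamma> u v = wf_digraph.\<mu> (with_proj \<Gamma>) (\<lambda>_. 1) u v"

definition resolving_set :: "'a pair_pre_digraph \<Rightarrow> 'a set \<Rightarrow> bool" where
  "resolving_set \<Gamma> W \<longleftrightarrow>
     W \<subseteq> pverts \<Gamma> \<and>
     (\<forall>u \<in> pverts \<Gamma>. \<forall>v \<in> pverts \<Gamma>. u \<noteq> v \<longrightarrow>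
        (\<exists>z \<in> W. graph_dist \<Gamma> u z \<noteq> graph_dist \<Gamma> v z))"

definition metric_dimension :: "'a pair_pre_digraph \<Rightarrow> nat" where
  "metric_dimension \<Gamma> = (LEAST m. \<exists>W. finite W \<and> resolving_set \<Gamma> W \<and> card W = m)"

text \<open>
  \<open>G\<close> is the group presented by \<open>\<langle>x, y | x\<^sup>n = y\<^sup>2 = e, xy = yx\<^sup>-\<^sup>1\<rangle>\<close>. As the presented group has
  order \<open>2n\<close>, a group generated by elements satisfying the relations is a quotient of it, and is
  the presented group itself exactly when it has order \<open>2n\<close>.
\<close>

definition is_dihedral :: "('a, 'b) monoid_scheme \<Rightarrow> nat \<Rightarrow> 'a \<Rightarrow> 'a \<Rightarrow> bool" where
  "is_dihedral G n x y \<longleftrightarrow>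
     group G \<and> order G = 2 * n \<and>
     x \<in> carrier G \<and> y \<in> carrier G \<and> generate G {x, y} = carrier G \<and>
     x [^]\<^bsub>G\<^esub> n = \<one>\<^bsub>G\<^esub> \<and> y [^]\<^bsub>G\<^esub> (2::nat) = \<one>\<^bsub>G\<^esub> \<and>
     x \<otimes>\<^bsub>G\<^esub> y = y \<otimes>\<^bsub>G\<^esub> inv\<^bsub>G\<^esub> x"

definition divisor_count :: "nat \<Rightarrow> nat" where
  "divisor_count n = card {d. d dvd n}"

lemma pair_graph_difference_graph:
  assumes "finite (carrier G)"
  shows "pair_graph (difference_graph G)"
proof -
  have "parcs (difference_graph G) \<subseteq> carrier G \<times> carrier G"
    by (auto simp: difference_graph_def delete_isolated_def enhanced_power_graph_def)
  then have "finite (parcs (difference_graph G))"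
    using assms by (meson finite_SigmaI finite_subset)
  moreover have "sym (parcs (difference_graph G))"
    by (auto simp: sym_def difference_graph_def delete_isolated_def enhanced_power_graph_def
        power_graph_def)
  moreover have "parcs (difference_graph G) \<subseteq>
      pverts (difference_graph G) \<times> pverts (difference_graph G)"
    by (auto simp: difference_graph_def delete_isolated_def enhanced_power_graph_def
        power_graph_def; blast)
  moreover have "finite (pverts (difference_graph G))"
    using assms by (auto simp: difference_graph_def delete_isolated_def)
  moreover have "fst e \<noteq> snd e" if "e \<in> parcs (difference_graph G)" for e
    using that by (auto simp: difference_graph_def delete_isolated_def enhanced_power_graph_def)
  ultimately show ?thesis
    by unfold_locales (auto simp: symmetric_def arcs_ends_def arc_to_ends_def)
qed

end

theory Submission
  imports Defs "HOL-Algebra.Multiplicative_Group"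
begin

text \<open>
  A reflection lies in no cyclic subgroup but its own, so the difference graph lives on \<open>\<langle>x\<rangle>\<close>, where
  two elements are adjacent iff their orders are incomparable for divisibility. Elements of equal
  order are twins, hence a resolving set omits at most one element of each order; as the occurring
  orders are the divisors of \<open>n\<close> other than \<open>1\<close> and \<open>n\<close>, this gives the lower bound
  \<open>n - \<phi>(n) - \<tau>(n) + 1\<close>. Omitting exactly one element of each order resolves the graph as soon as any
  two orders are told apart by comparability with an order other than \<open>2\<close>, the only order whose
  class is thereby emptied. This fails only for the orders \<open>p\<close> and \<open>2 * p\<close> when \<open>n = 2 ^ k * p\<close> with
  \<open>k > 1\<close>; then the involution of \<open>\<langle>x\<rangle>\<close> must be added.
\<close>

section \<open>Comparability of divisors\<close>

definition dvd_comparable :: "nat \<Rightarrow> nat \<Rightarrow> bool" where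
  "dvd_comparable a b \<longleftrightarrow> a dvd b \<or> b dvd a"

lemma dvd_comparable_refl [simp]: "dvd_comparable a a"
  by (simp add: dvd_comparable_def)

lemma dvd_comparable_commute: "dvd_comparable a b \<longleftrightarrow> dvd_comparable b a"
  by (auto simp: dvd_comparable_def)

text \<open>The divisors of a prime power form a chain. This is why the graph is empty when
  \<open>n\<close> is a prime power.\<close>

lemma dvd_comparable_prime_power:
  assumes "prime p" "a dvd p ^ k" "b dvd p ^ k"
  shows "dvd_comparable a b"
proof -
  obtain i j where "a = p ^ i" "b = p ^ j"
    using assms divides_primepow_nat by metis
  then show ?thesis
    unfolding dvd_comparable_def by (metis le_imp_power_dvd nat_le_linear)
qed

text \<open>Split \<open>N = p ^ k * t\<close> with \<open>t\<close> prime to \<open>p\<close> and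
  \<open>t \<noteq> 1\<close>. If \<open>t\<close> divides \<open>m\<close>, then
  \<open>p ^ k\<close> works because \<open>m \<noteq> N\<close>; if \<open>m\<close> divides
  \<open>t\<close> properly, then \<open>p\<close> works because \<open>m \<noteq> 1\<close>;
  otherwise \<open>t\<close> works.\<close>

lemma exists_incomparable_divisor:
  fixes m N :: nat
  assumes "m dvd N" "m \<noteq> 1" "m \<noteq> N" "N > 0"
    and not_pp: "\<nexists>p k. prime p \<and> N = p ^ k"
  shows "\<exists>g. g dvd N \<and> \<not> dvd_comparable m g"
proof -
  have "N \<noteq> 1"
    using not_pp by (metis power_0 two_is_prime_nat)
  then obtain p where p: "prime p" "p dvd N"
    using prime_factor_nat by blast
  then obtain t where t: "N = p ^ multiplicity p N * t" "\<not> p dvd t"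
    using \<open>N > 0\<close> by (metis multiplicity_decompose' neq0_conv not_prime_unit)
  define k where "k = multiplicity p N"
  have N: "N = p ^ k * t"
    using t by (simp add: k_def)
  have "t \<noteq> 1"
    using not_pp p N by (metis mult.right_neutral)
  have cop: "coprime (p ^ k) t"
    using p t by (simp add: prime_imp_coprime)
  consider "t dvd m" | "m dvd t" "\<not> t dvd m" | "\<not> dvd_comparable m t"
    by (auto simp: dvd_comparable_def)
  then show ?thesis
  proof cases
    case 1
    have "\<not> p ^ k dvd m"
      using divides_mult[OF _ 1 cop] N assms(1,3) by (metis dvd_antisym)
    moreover have "\<not> m dvd p ^ k"
      using 1 \<open>t \<noteq> 1\<close> cop by (metis coprime_common_divisor dvd_refl dvd_trans nat_dvd_1_iff_1)
    ultimately show ?thesis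
      using N by (auto simp: dvd_comparable_def intro!: exI[of _ "p ^ k"])
  next
    case 2
    then have "\<not> p dvd m"
      using t by (meson dvd_trans)
    moreover have "\<not> m dvd p"
      using calculation p assms(2) by (metis dvd_refl prime_nat_iff)
    ultimately show ?thesis
      using p by (auto simp: dvd_comparable_def)
  next
    case 3
    then show ?thesis
      using N by (metis dvd_triv_right)
  qed
qed

text \<open>\<open>1\<close> and \<open>n\<close> are left out because they are comparable with
  every divisor of \<open>n\<close>: elements of these orders are isolated.\<close>

definition proper_divisors :: "nat \<Rightarrow> nat set" where
  "proper_divisors n = {d. d dvd n} - {1, n}"

text \<open>
  If \<open>d\<close> and \<open>e\<close> are incomparable, one of them separates them. If \<open>e = d * m\<close>, a divisor of
  \<open>n div d\<close> incomparable with \<open>m\<close> yields a separating divisor, and so does a divisor of \<open>e\<close>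
  incomparable with \<open>d\<close>. The first can only fail when \<open>n div d\<close> is a power of a prime \<open>q\<close>, and then
  the second is the full \<open>q\<close>-part of \<open>e\<close>, unless that is \<open>2\<close>. In that case \<open>e = 2 * d\<close> with \<open>d\<close> odd,
  and \<open>2 * r\<close> separates them for every nontrivial proper divisor \<open>r\<close> of \<open>d\<close>.
\<close>

lemma separating_divisor_dvd:
  fixes d e n :: nat
  assumes n: "n > 0" and not_pp: "\<nexists>p k. prime p \<and> n = p ^ k"
    and d: "d \<in> proper_divisors n" and e: "e \<in> proper_divisors n" and "d \<noteq> e" "d dvd e"
  shows "(\<exists>f \<in> proper_divisors n - {2}. dvd_comparable f d \<noteq> dvd_comparable f e) \<or>
    (\<exists>k p. 1 < k \<and> prime p \<and> p \<noteq> 2 \<and> n = 2 ^ k * p \<and> d = p \<and> e = 2 * p)"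
proof -
  obtain m where m: "e = d * m"
    using \<open>d dvd e\<close> by blast
  have dd: "d dvd n" "d \<noteq> 1" "d \<noteq> n" "d > 0" and ee: "e dvd n" "e \<noteq> 1" "e \<noteq> n" "e > 0"
    using d e n by (auto simp: proper_divisors_def)
  define N where "N = n div d"
  have nN: "n = d * N" and "N > 0"
    using dd n by (auto simp: N_def)
  have m': "m dvd N" "m \<noteq> 1" "m \<noteq> N"
    using m nN ee dd \<open>d \<noteq> e\<close> by auto
  show ?thesis
  proof (cases "\<exists>q a. prime q \<and> N = q ^ a")
    case False
    then obtain g where g: "g dvd N" "\<not> dvd_comparable m g"
      using exists_incomparable_divisor m' \<open>N > 0\<close> by blast
    \<comment> \<open>Scaling by \<open>d\<close> turns the incomparable pair \<open>m\<close>,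
      \<open>g\<close> into \<open>e\<close>, \<open>d * g\<close>. The product is not
      \<open>2\<close>, as both factors exceed \<open>1\<close>.\<close>
    have "d * g \<in> proper_divisors n - {2}"
      using g m' dd nN by (auto simp: proper_divisors_def dvd_comparable_def)
         (metis Suc_1 dvd_1_left dvd_refl mult.right_neutral mult_eq_self_implies_10
           nat_dvd_not_less not_prime_0 prime_nat_iff two_is_prime_nat dvd_triv_left)
    moreover have "\<not> dvd_comparable (d * g) e" "dvd_comparable (d * g) d"
      using g m dd by (auto simp: dvd_comparable_def)
    ultimately show ?thesis
      by blast
  next
    case True
    then obtain q a where q: "prime q" and N: "N = q ^ a"
      by blast
    then obtain b where b: "m = q ^ b" "b \<le> a"
      using m' divides_primepow_nat by metis
    \<comment> \<open>\<open>b < a\<close> expresses \<open>e \<noteq> n\<close>; it later supplies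
      the bound \<open>1 < k\<close> of the exceptional case.\<close>
    have "b < a" "b > 0"
      using m' b N by (auto simp: le_less intro!: Nat.gr0I)
    obtain t where t: "d = q ^ multiplicity q d * t" "\<not> q dvd t"
      using dd q by (metis multiplicity_decompose' neq0_conv not_prime_unit)
    define s where "s = multiplicity q d"
    have ds: "d = q ^ s * t"
      using t by (simp add: s_def)
    have n_eq: "n = q ^ (s + a) * t" and e_eq: "e = q ^ (s + b) * t"
      using nN N ds m b by (auto simp: power_add)
    have "t \<noteq> 1"
      using n_eq not_pp q by (metis mult.right_neutral)
    have cop: "coprime (q ^ i) t" for i
      using q t by (simp add: prime_imp_coprime)
    define f where "f = q ^ (s + b)"
    have "\<not> d dvd f"
      unfolding f_def using ds \<open>t \<noteq> 1\<close> cop[of "s + b"]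
      by (metis coprime_common_divisor dvd_refl dvd_trans dvd_triv_right nat_dvd_1_iff_1)
    moreover have "\<not> f dvd d"
    proof
      assume "f dvd d"
      then have "q ^ (s + b) dvd q ^ s"
        using cop[of "s + b"] ds f_def by (simp add: coprime_dvd_mult_left_iff)
      then show False
        using power_dvd_imp_le[of q "s + b" s] prime_gt_1_nat[OF q] \<open>b > 0\<close> by simp
    qed
    ultimately have fd: "\<not> dvd_comparable f d"
      by (auto simp: dvd_comparable_def)
    have fe: "f dvd e"
      using e_eq f_def by simp
    show ?thesis
    proof (cases "f = 2")
      case False
      have "f \<in> proper_divisors n"
        using fd fe ee dd by (auto simp: proper_divisors_def dvd_comparable_def)
      then show ?thesis
        using False fd fe by (auto simp: dvd_comparable_def)
    next
      case True
      have "q dvd f"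
        using \<open>b > 0\<close> by (simp add: f_def)
      then have "q = 2"
        using True q primes_dvd_imp_eq two_is_prime_nat by blast
      then have "s + b = 1"
        using True f_def power_inject_exp[of "2::nat" "s + b" 1] by simp
      then have "s = 0" "b = 1"
        using \<open>b > 0\<close> by auto
      then have d_t: "d = t" and e_t: "e = 2 * t" and n_t: "n = 2 ^ a * t"
        using ds e_eq n_eq \<open>q = 2\<close> by auto
      show ?thesis
      proof (cases "prime t")
        case True
        moreover have "1 < a" "t \<noteq> 2"
          using \<open>b < a\<close> \<open>b = 1\<close> t \<open>q = 2\<close> by auto
        ultimately show ?thesis
          using d_t e_t n_t by blast
      next
        case False
        then obtain r where r: "r dvd t" "r \<noteq> 1" "r \<noteq> t"
          using \<open>t \<noteq> 1\<close> by (metis One_nat_def prime_nat_iff dd(4) d_t Suc_lessI)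
        then obtain w where w: "t = r * w"
          by blast
        have "odd w" "odd r" "w \<noteq> 1"
          using w t \<open>q = 2\<close> r by auto
        have "r > 0"
          using \<open>odd r\<close> by (rule odd_pos)
        \<comment> \<open>Cancelling \<open>r\<close> would leave the cofactor \<open>w\<close>
          dividing \<open>2\<close>, but \<open>w\<close> is odd and not \<open>1\<close>.\<close>
        have "\<not> t dvd 2 * r"
        proof
          assume "t dvd 2 * r"
          then have "w dvd 2"
            using \<open>r > 0\<close> w by (simp add: mult.commute[of 2])
          then show False
            using \<open>odd w\<close> \<open>w \<noteq> 1\<close> prime_nat_iff two_is_prime_nat by blast
        qed
        moreover have "\<not> 2 * r dvd t"
          using t \<open>q = 2\<close> dvd_mult_left by blast
        moreover have "2 * r dvd e"
          using e_t r by simp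
        moreover have "2 * r \<noteq> 2"
          using r by simp
        moreover have "2 * r \<in> proper_divisors n"
          using calculation ee d_t dd by (auto simp: proper_divisors_def intro: dvd_trans)
        ultimately show ?thesis
          using d_t by (auto simp: dvd_comparable_def intro!: bexI[of _ "2 * r"])
      qed
    qed
  qed
qed

lemma separating_divisor:
  fixes d e n :: nat
  assumes n: "n > 0" and not_pp: "\<nexists>p k. prime p \<and> n = p ^ k"
    and d: "d \<in> proper_divisors n" and e: "e \<in> proper_divisors n" and "d \<noteq> e"
  shows "(\<exists>f \<in> proper_divisors n - {2}. dvd_comparable f d \<noteq> dvd_comparable f e) \<or>
    (\<exists>k p. 1 < k \<and> prime p \<and> p \<noteq> 2 \<and> n = 2 ^ k * p \<and> {d, e} = {p, 2 * p})"
proof (cases "dvd_comparable d e")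
  case True
  then consider "d dvd e" | "e dvd d"
    by (auto simp: dvd_comparable_def)
  then show ?thesis
  proof cases
    case 1
    then show ?thesis
      using separating_divisor_dvd[OF n not_pp d e \<open>d \<noteq> e\<close>] by blast
  next
    case 2
    then consider
        f where "f \<in> proper_divisors n - {2}" "dvd_comparable f d \<noteq> dvd_comparable f e"
      | k p where "1 < k" "prime p" "p \<noteq> 2" "n = 2 ^ k * p" "e = p" "d = 2 * p"
      using separating_divisor_dvd[OF n not_pp e d] \<open>d \<noteq> e\<close> by blast
    then show ?thesis
    proof cases
      case 1
      then show ?thesis
        by blast
    next
      case 2
      then have "{d, e} = {p, 2 * p}"
        by auto
      then show ?thesis
        using 2 by blast
    qed
  qed
next
  case False
  \<comment> \<open>Both \<open>d\<close> and \<open>e\<close> separate the pair, being comparable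
    with themselves only, and at most one of them is the forbidden \<open>2\<close>.\<close>
  then have "dvd_comparable d d \<noteq> dvd_comparable d e" "dvd_comparable e d \<noteq> dvd_comparable e e"
    using dvd_comparable_commute by auto
  then show ?thesis
    using d e \<open>d \<noteq> e\<close> by (cases "d = 2") blast+
qed

section \<open>Distances and twins\<close>

context pair_wf_digraph
begin

text \<open>With unit costs the cost of a walk is its length, so single walks give upper bounds and
  case analysis on walks gives lower bounds.\<close>

lemma graph_dist_eq: "graph_dist G u v = (INF p \<in> {p. awalk u p v}. ereal (length p))"
  by (simp add: graph_dist_def \<mu>_def awalk_cost_def sum_list_triv)

lemma graph_dist_le: "awalk u p v \<Longrightarrow> graph_dist G u v \<le> ereal (length p)"
  unfolding graph_dist_eq by (rule INF_lower) simp

lemma graph_dist_ge: "(\<And>p. awalk u p v \<Longrightarrow> b \<le> ereal (length p)) \<Longrightarrow> b \<le> graph_dist G u v"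
  unfolding graph_dist_eq by (rule INF_greatest) simp

lemma graph_dist_self:
  assumes "u \<in> pverts G"
  shows "graph_dist G u u = 0"
proof (rule antisym)
  show "graph_dist G u u \<le> 0"
    using graph_dist_le[of u "[]" u] assms by (simp add: awalk_Nil_iff zero_ereal_def)
  show "0 \<le> graph_dist G u u"
    by (rule graph_dist_ge) simp
qed

lemma graph_dist_pos:
  assumes "u \<noteq> v"
  shows "1 \<le> graph_dist G u v"
proof (rule graph_dist_ge)
  fix p
  assume "awalk u p v"
  then have "p \<noteq> []"
    using assms by (auto simp: awalk_Nil_iff)
  then show "1 \<le> ereal (length p)"
    by (cases p) auto
qed

lemma graph_dist_ge_2:
  assumes "u \<noteq> v" "(u, v) \<notin> parcs G"
  shows "2 \<le> graph_dist G u v"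
proof (rule graph_dist_ge)
  fix p
  assume p: "awalk u p v"
  have "length p \<noteq> 0"
    using p assms by (auto simp: awalk_Nil_iff)
  moreover have "length p \<noteq> 1"
    using p assms by (auto simp: length_Suc_conv awalk_Cons_iff awalk_Nil_iff)
  ultimately have "2 \<le> length p"
    by linarith
  then show "2 \<le> ereal (length p)"
    by simp
qed

lemma graph_dist_le_2:
  assumes "(u, w) \<in> parcs G" "(w, v) \<in> parcs G"
  shows "graph_dist G u v \<le> 2"
proof -
  have "awalk u [(u, w), (w, v)] v"
    using assms arc_fst_in_verts arc_snd_in_verts by (force simp: awalk_Cons_iff awalk_Nil_iff)
  from graph_dist_le[OF this] show ?thesis
    by simp
qed

text \<open>Loops are excluded since a vertex is at distance \<open>0\<close> from itself.\<close>

lemma graph_dist_eq_1_iff: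
  assumes "u \<in> pverts G" "(u, u) \<notin> parcs G"
  shows "graph_dist G u v = 1 \<longleftrightarrow> (u, v) \<in> parcs G"
proof
  assume *: "graph_dist G u v = 1"
  then have "u \<noteq> v"
    using graph_dist_self[OF assms(1)] by auto
  then show "(u, v) \<in> parcs G"
    using graph_dist_ge_2[of u v] * by auto
next
  assume *: "(u, v) \<in> parcs G"
  then have "u \<noteq> v"
    using assms by auto
  have "awalk u [(u, v)] v"
    using * arc_fst_in_verts arc_snd_in_verts by (force simp: awalk_Cons_iff awalk_Nil_iff)
  from graph_dist_le[OF this] graph_dist_pos[OF \<open>u \<noteq> v\<close>] show "graph_dist G u v = 1"
    by (simp add: antisym one_ereal_def)
qed

text \<open>The first arc of a walk from \<open>u\<close> may be redirected to start at \<open>v\<close>.\<close>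

lemma graph_dist_mono_neighbours:
  assumes "\<And>w. (u, w) \<in> parcs G \<Longrightarrow> (v, w) \<in> parcs G" "z \<noteq> u"
  shows "graph_dist G v z \<le> graph_dist G u z"
proof (rule graph_dist_ge)
  fix p
  assume p: "awalk u p z"
  then obtain w q where q: "p = (u, w) # q" "(u, w) \<in> parcs G" "awalk w q z"
    using assms(2) by (cases p) (auto simp: awalk_Nil_iff awalk_Cons_iff)
  then have "awalk v ((v, w) # q) z"
    using assms(1)[of w] arc_fst_in_verts by (force simp: awalk_Cons_iff)
  from graph_dist_le[OF this] show "graph_dist G v z \<le> ereal (length p)"
    using q by simp
qed

end

section \<open>Metric dimension of an incomparability graph of divisors\<close>

text \<open>Isolates what the metric dimension depends on: \<open>c\<close> stands for the element
  order, and the group enters only through the class sizes and the adjacency rule.\<close>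

locale divisor_graph = pair_graph G for G :: "'a pair_pre_digraph" +
  fixes n :: nat and c :: "'a \<Rightarrow> nat"
  assumes n_pos: "n > 0"
    and not_prime_power: "\<nexists>p k. prime p \<and> n = p ^ k"
    and c_proper: "v \<in> pverts G \<Longrightarrow> c v \<in> proper_divisors n"
    and card_class: "d \<in> proper_divisors n \<Longrightarrow> card {v \<in> pverts G. c v = d} = totient d"
    and arc_iff: "(u, v) \<in> parcs G \<longleftrightarrow>
      u \<in> pverts G \<and> v \<in> pverts G \<and> \<not> dvd_comparable (c u) (c v)"
begin

section \<open>Counting vertices by order\<close>

lemma n_gt_1: "n > 1"
  using n_pos not_prime_power by (metis One_nat_def Suc_lessI power_0 two_is_prime_nat)

lemma finite_divisors: "finite {d. d dvd n}"
  using n_pos by (simp add: finite_divisors_nat)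

lemma finite_proper: "finite (proper_divisors n)"
  by (simp add: proper_divisors_def finite_divisors)

lemma proper_pos: "d \<in> proper_divisors n \<Longrightarrow> d > 1"
  using n_pos by (auto simp: proper_divisors_def intro!: Nat.gr0I Suc_lessI)

lemma card_proper: "card (proper_divisors n) = divisor_count n - 2"
proof -
  have "card (proper_divisors n) = card {d. d dvd n} - card {1, n}"
    unfolding proper_divisors_def by (rule card_Diff_subset) auto
  then show ?thesis
    using n_gt_1 by (simp add: divisor_count_def)
qed

lemma divisor_count_ge_2: "divisor_count n \<ge> 2"
proof -
  have "card {1, n} \<le> card {d. d dvd n}"
    by (rule card_mono) (auto simp: finite_divisors)
  then show ?thesis
    using n_gt_1 by (simp add: divisor_count_def)
qed

text \<open>Gauss's identity: the totients of all divisors of \<open>n\<close> sum to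
  \<open>n\<close>. The divisors \<open>1\<close> and \<open>n\<close> contribute \<open>1\<close>
  and \<open>totient n\<close>, the others count the vertices.\<close>

lemma card_pverts: "card (pverts G) + totient n + 1 = n"
proof -
  have "card (pverts G) = (\<Sum>d \<in> c ` pverts G. card {v \<in> pverts G. c v = d})"
    using sum.image_gen[OF pair_finite_verts, of "\<lambda>_. 1 :: nat" c] by simp
  also have "\<dots> = (\<Sum>d \<in> proper_divisors n. card {v \<in> pverts G. c v = d})"
  proof (rule sum.mono_neutral_left)
    show "\<forall>d \<in> proper_divisors n - c ` pverts G. card {v \<in> pverts G. c v = d} = 0"
      by (metis (mono_tags, lifting) DiffD2 card.empty empty_Collect_eq image_eqI)
  qed (use finite_proper c_proper in auto)
  finally have "card (pverts G) = (\<Sum>d \<in> proper_divisors n. card {v \<in> pverts G. c v = d})" .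
  then have "card (pverts G) = (\<Sum>d \<in> proper_divisors n. totient d)"
    using card_class by simp
  moreover have "(\<Sum>d | d dvd n. totient d) = (\<Sum>d \<in> {1, n}. totient d) + (\<Sum>d \<in> proper_divisors n. totient d)"
    unfolding proper_divisors_def using finite_divisors
    by (subst sum.subset_diff[of "{1, n}"]) auto
  ultimately show ?thesis
    using n_gt_1 by (simp add: totient_divisor_sum)
qed

lemma class_nonempty:
  assumes "d \<in> proper_divisors n"
  shows "\<exists>v. v \<in> pverts G \<and> c v = d"
proof -
  have "totient d > 0"
    using proper_pos[OF assms] by simp
  then have "{v \<in> pverts G. c v = d} \<noteq> {}"
    using card_class[OF assms] by (metis card.empty less_irrefl)
  then show ?thesis
    by blast
qed

text \<open>For \<open>d > 2\<close> the totient exceeds \<open>1\<close>, so the class of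
  \<open>d\<close> survives the removal of any one element.\<close>

lemma class_has_other:
  assumes "d \<in> proper_divisors n" "d \<noteq> 2"
  shows "\<exists>v. v \<in> pverts G \<and> c v = d \<and> v \<noteq> w"
proof -
  have "totient d > 1"
    using proper_pos[OF assms(1)] assms(2) by (intro totient_gt_1) auto
  then have "\<not> {v \<in> pverts G. c v = d} \<subseteq> {w}"
    using card_class[OF assms(1)] card_mono[of "{w}" "{v \<in> pverts G. c v = d}"] by auto
  then show ?thesis
    by blast
qed

lemma class_2_unique:
  assumes "u \<in> pverts G" "v \<in> pverts G" "c u = 2" "c v = 2"
  shows "u = v"
proof -
  have "card {v \<in> pverts G. c v = 2} = 1"
    using card_class[of 2] c_proper assms by force
  then obtain w where "{v \<in> pverts G. c v = 2} = {w}"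
    using card_1_singletonE by metis
  then show ?thesis
    using assms by (metis (mono_tags, lifting) mem_Collect_eq singletonD)
qed

section \<open>Twins and the lower bound\<close>

lemma no_loop: "(u, u) \<notin> parcs G"
  by (simp add: arc_iff)

text \<open>Exactly one of \<open>u\<close> and \<open>v\<close> is adjacent to \<open>z\<close>,
  hence exactly one of the distances is \<open>1\<close>.\<close>

lemma graph_dist_separated:
  assumes "u \<in> pverts G" "v \<in> pverts G" "z \<in> pverts G"
    "dvd_comparable (c z) (c u) \<noteq> dvd_comparable (c z) (c v)"
  shows "graph_dist G u z \<noteq> graph_dist G v z"
proof -
  have "((u, z) \<in> parcs G) \<noteq> ((v, z) \<in> parcs G)"
    using assms by (simp add: arc_iff dvd_comparable_commute)
  then show ?thesis
    using assms graph_dist_eq_1_iff no_loop by metis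
qed

lemma graph_dist_self_neq:
  assumes "u \<in> pverts G" "u \<noteq> v"
  shows "graph_dist G u u \<noteq> graph_dist G v u"
  using graph_dist_self[OF assms(1)] graph_dist_pos[of v u] assms(2) by auto

text \<open>Equal values of \<open>c\<close> give equal neighbourhoods, so walks can be redirected
  in both directions.\<close>

lemma graph_dist_twins:
  assumes "u \<in> pverts G" "v \<in> pverts G" "c u = c v" "z \<noteq> u" "z \<noteq> v"
  shows "graph_dist G u z = graph_dist G v z"
  using assms by (intro antisym graph_dist_mono_neighbours) (auto simp: arc_iff)

text \<open>Twins are told apart only by one of themselves, so two of them cannot both be
  omitted.\<close>

lemma resolving_set_inj_on:
  assumes "resolving_set G W"
  shows "inj_on c (pverts G - W)"
proof (rule inj_onI)
  fix u v
  assume *: "u \<in> pverts G - W" "v \<in> pverts G - W" "c u = c v"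
  show "u = v"
  proof (rule ccontr)
    assume "u \<noteq> v"
    then obtain z where "z \<in> W" "graph_dist G u z \<noteq> graph_dist G v z"
      using assms * unfolding resolving_set_def by blast
    then show False
      using graph_dist_twins[of u v z] * by auto
  qed
qed

lemma card_resolving_set:
  assumes "resolving_set G W"
  shows "card (pverts G - W) \<le> card (proper_divisors n)"
    and "card (pverts G) = card W + card (pverts G - W)"
proof -
  show "card (pverts G - W) \<le> card (proper_divisors n)"
    by (rule card_inj_on_le[OF resolving_set_inj_on[OF assms]])
      (use c_proper finite_proper in auto)
  have "W \<subseteq> pverts G"
    using assms by (simp add: resolving_set_def)
  then show "card (pverts G) = card W + card (pverts G - W)"
    using pair_finite_verts by (metis card_Diff_subset card_mono finite_subset le_add_diff_inverse)
qed

section \<open>Omitting one representative of each order\<close>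

definition rep :: "nat \<Rightarrow> 'a" where
  "rep d = (SOME v. v \<in> pverts G \<and> c v = d)"

lemma rep:
  assumes "d \<in> proper_divisors n"
  shows "rep d \<in> pverts G" "c (rep d) = d"
  using someI_ex[OF class_nonempty[OF assms]] by (auto simp: rep_def)

text \<open>The candidate resolving set: its size is the least that the twin bound permits.\<close>

definition non_reps :: "'a set" where
  "non_reps = pverts G - rep ` proper_divisors n"

lemma card_non_reps: "card non_reps + card (proper_divisors n) = card (pverts G)"
proof -
  have "inj_on rep (proper_divisors n)"
    by (rule inj_on_inverseI[of _ c]) (simp add: rep)
  moreover have "rep ` proper_divisors n \<subseteq> pverts G"
    using rep by auto
  ultimately show ?thesis
    unfolding non_reps_def using pair_finite_verts
    by (metis card_Diff_subset card_image card_mono finite_subset le_add_diff_inverse2)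
qed

text \<open>A vertex of \<open>W\<close> resolves itself from any other, by distance
  \<open>0\<close>. What remains are pairs of representatives, which have different orders, and for
  these a difference in adjacency suffices.\<close>

lemma resolving_setI:
  assumes W: "non_reps \<subseteq> W" "W \<subseteq> pverts G"
    and sep: "\<And>d e. d \<in> proper_divisors n \<Longrightarrow> e \<in> proper_divisors n \<Longrightarrow> d \<noteq> e \<Longrightarrow>
      \<exists>z \<in> W. dvd_comparable (c z) d \<noteq> dvd_comparable (c z) e"
  shows "resolving_set G W"
  unfolding resolving_set_def
proof (intro conjI ballI impI)
  fix u v
  assume uv: "u \<in> pverts G" "v \<in> pverts G" "u \<noteq> v"
  show "\<exists>z\<in>W. graph_dist G u z \<noteq> graph_dist G v z"
  proof (cases "u \<in> W \<or> v \<in> W")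
    case True
    then show ?thesis
      using uv graph_dist_self_neq by metis
  next
    case False
    then obtain d e where de: "d \<in> proper_divisors n" "e \<in> proper_divisors n" "u = rep d" "v = rep e"
      using uv W unfolding non_reps_def by blast
    then obtain z where z: "z \<in> W" "dvd_comparable (c z) d \<noteq> dvd_comparable (c z) e"
      using sep[of d e] uv by auto
    then have "graph_dist G u z \<noteq> graph_dist G v z"
      using graph_dist_separated[of u v z] uv de rep W by auto
    then show ?thesis
      using z by blast
  qed
qed (fact W)

lemma non_rep_in_class:
  assumes "f \<in> proper_divisors n - {2}"
  shows "\<exists>z \<in> non_reps. c z = f"
proof -
  obtain z where z: "z \<in> pverts G" "c z = f" "z \<noteq> rep f"
    using class_has_other assms by blast
  then have "z \<in> non_reps"
    unfolding non_reps_def using rep by auto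
  then show ?thesis
    using z by blast
qed

lemma metric_dimension_eqI:
  assumes "resolving_set G W" "card W = m"
    and "\<And>W'. resolving_set G W' \<Longrightarrow> m \<le> card W'"
  shows "metric_dimension G = m"
  unfolding metric_dimension_def
proof (rule Least_equality)
  have "finite W"
    using assms(1) pair_finite_verts by (auto simp: resolving_set_def intro: finite_subset)
  then show "\<exists>W. finite W \<and> resolving_set G W \<and> card W = m"
    using assms by blast
qed (use assms(3) in blast)

text \<open>The separating order is never \<open>2\<close>, so some vertex of that order lies in
  \<open>non_reps\<close>; the twin bound shows that no smaller set resolves.\<close>

lemma metric_dimension_generic:
  assumes "\<nexists>k p. 1 < k \<and> prime p \<and> p \<noteq> 2 \<and> n = 2 ^ k * p"
  shows "metric_dimension G = card non_reps"
proof (rule metric_dimension_eqI)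
  show "resolving_set G non_reps"
  proof (rule resolving_setI)
    fix d e
    assume "d \<in> proper_divisors n" "e \<in> proper_divisors n" "d \<noteq> e"
    then obtain f where "f \<in> proper_divisors n - {2}" "dvd_comparable f d \<noteq> dvd_comparable f e"
      using separating_divisor[OF n_pos not_prime_power, of d e] assms by blast
    then show "\<exists>z \<in> non_reps. dvd_comparable (c z) d \<noteq> dvd_comparable (c z) e"
      using non_rep_in_class by metis
  qed (auto simp: non_reps_def)
  show "card non_reps \<le> card W'" if "resolving_set G W'" for W'
    using card_resolving_set[OF that] card_non_reps by linarith
qed simp

text \<open>
  When \<open>n = 2 ^ k * p\<close> the classes of \<open>p\<close> and \<open>2 * p\<close> are only told apart by the single element
  of the class of \<open>2\<close>.
\<close>

lemma metric_dimension_exceptional: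
  assumes k: "1 < k" and p: "prime p" "p \<noteq> 2" and n: "n = 2 ^ k * p"
  shows "metric_dimension G = card non_reps + 1"
proof (rule metric_dimension_eqI)
  have "odd p"
    using p primes_dvd_imp_eq two_is_prime_nat by blast
  have "p > 1"
    using p prime_gt_1_nat by blast
  have div4: "4 dvd (2 :: nat) ^ k"
    using k le_imp_power_dvd[of 2 k "2 :: nat"] by simp
  have "(2 :: nat) < 2 ^ k"
    using k power_strict_increasing[of 1 k "2 :: nat"] by simp
  moreover have "2 ^ k * 1 \<le> n"
    unfolding n using \<open>p > 1\<close> by (intro mult_le_mono2) simp
  ultimately have "n > 2"
    by simp
  then have proper: "2 \<in> proper_divisors n" "p \<in> proper_divisors n" "2 * p \<in> proper_divisors n"
      "2 ^ k \<in> proper_divisors n"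
    using n \<open>p > 1\<close> \<open>2 < 2 ^ k\<close> k by (auto simp: proper_divisors_def intro: dvd_mult2)
  define a where "a = rep 2"
  have a: "a \<in> pverts G" "c a = 2" "a \<notin> non_reps"
    using rep proper by (auto simp: a_def non_reps_def)
  define W where "W = insert a non_reps"
  show "card W = card non_reps + 1"
    unfolding W_def using a pair_finite_verts by (simp add: non_reps_def)
  show "resolving_set G W"
  proof (rule resolving_setI)
    fix d e
    assume "d \<in> proper_divisors n" "e \<in> proper_divisors n" "d \<noteq> e"
    then consider f where "f \<in> proper_divisors n - {2}" "dvd_comparable f d \<noteq> dvd_comparable f e"
      | q where "prime q" "q \<noteq> 2" "{d, e} = {q, 2 * q}"
      using separating_divisor[OF n_pos not_prime_power, of d e] by blast
    then show "\<exists>z \<in> W. dvd_comparable (c z) d \<noteq> dvd_comparable (c z) e"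
    proof cases
      case 1
      then show ?thesis
        unfolding W_def using non_rep_in_class by (metis insertCI)
    next
      case 2
      then have "\<not> 2 dvd q" "\<not> q dvd 2"
        using primes_dvd_imp_eq two_is_prime_nat by blast+
      then have "\<not> dvd_comparable 2 q" "dvd_comparable 2 (2 * q)"
        by (auto simp: dvd_comparable_def)
      then have "dvd_comparable (c a) d \<noteq> dvd_comparable (c a) e"
        using 2(3) a(2) by (auto simp: doubleton_eq_iff)
      then show ?thesis
        by (auto simp: W_def)
    qed
  qed (use a in \<open>auto simp: W_def non_reps_def\<close>)
  show "card non_reps + 1 \<le> card W'" if W': "resolving_set G W'" for W'
  proof (rule ccontr)
    assume "\<not> ?thesis"
    \<comment> \<open>A set this small meets the twin bound with equality, so it omits exactly one
      vertex of every order. In particular it omits the only vertex of order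
      \<open>2\<close>.\<close>
    then have "card (pverts G - W') = card (proper_divisors n)"
      using card_resolving_set[OF W'] card_non_reps by linarith
    then have "card (c ` (pverts G - W')) = card (proper_divisors n)"
      using resolving_set_inj_on[OF W'] by (simp add: card_image)
    then have onto: "c ` (pverts G - W') = proper_divisors n"
      using c_proper finite_proper by (intro card_subset_eq) auto
    then obtain b where b: "b \<in> pverts G - W'" "c b = 2"
      using proper by (metis imageE)
    obtain u where u: "u \<in> pverts G - W'" "c u = p"
      using proper onto by (metis imageE)
    obtain v where v: "v \<in> pverts G - W'" "c v = 2 * p"
      using proper onto by (metis imageE)
    have "u \<noteq> v"
      using u v \<open>p > 1\<close> by auto
    then obtain z where z: "z \<in> W'" "graph_dist G u z \<noteq> graph_dist G v z"
      using W' u v unfolding resolving_set_def by blast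
    have zG: "z \<in> pverts G"
      using z W' by (auto simp: resolving_set_def)
    have "z \<noteq> u" "z \<noteq> v" "c z \<noteq> 2"
      using z u v b zG class_2_unique[of z b] by auto
    \<comment> \<open>\<open>h\<close> is adjacent to both \<open>u\<close> and \<open>v\<close>; it
      will serve as the midpoint of walks of length \<open>2\<close> to \<open>z\<close>.\<close>
    obtain h where h: "h \<in> pverts G" "c h = 2 ^ k"
      using class_nonempty proper by blast
    have p_pk: "\<not> p dvd 2 ^ k"
      using p prime_dvd_power primes_dvd_imp_eq two_is_prime_nat by blast
    have not4: "\<not> 4 dvd 2 * p"
      using \<open>odd p\<close> by presburger
    have npk: "\<not> dvd_comparable p (2 ^ k)" "\<not> dvd_comparable (2 * p) (2 ^ k)"
      using p_pk not4 div4 \<open>odd p\<close> dvd_trans[of 4 "2 ^ k" "2 * p"] dvd_trans[of 2 4 "2 ^ k"]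
        dvd_trans[of 2 "2 ^ k" p] by (auto simp: dvd_comparable_def dest: dvd_mult_right)
    have cz: "c z dvd 2 ^ k * p" "c z \<noteq> 1" "c z \<noteq> 2 ^ k * p"
      using c_proper[OF zG] n by (auto simp: proper_divisors_def)
    show False
    proof (cases "p dvd c z")
      \<comment> \<open>Here \<open>c z = 2 ^ i\<close> with \<open>i \<ge> 2\<close>. As
        \<open>4\<close> does not divide \<open>2 * p\<close>, \<open>z\<close> is adjacent to both
        \<open>u\<close> and \<open>v\<close>, and both distances are \<open>1\<close>.\<close>
      case False
      then have "coprime (c z) p"
        using p by (simp add: coprime_commute prime_imp_coprime)
      then have "c z dvd 2 ^ k"
        using cz by (simp add: coprime_dvd_mult_left_iff)
      then obtain i where i: "c z = 2 ^ i"
        using divides_primepow_nat two_is_prime_nat by metis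
      then have "i \<noteq> 0" "i \<noteq> 1"
        using cz \<open>c z \<noteq> 2\<close> by auto
      then have "4 dvd c z"
        using i le_imp_power_dvd[of 2 i "2 :: nat"] by simp
      then have "\<not> c z dvd 2 * p"
        using not4 dvd_trans by blast
      then have "\<not> dvd_comparable (2 * p) (c z)" "\<not> dvd_comparable p (c z)"
        using False by (auto simp: dvd_comparable_def dest: dvd_mult_right)
      then show False
        using z u v zG graph_dist_eq_1_iff no_loop arc_iff by (metis DiffD1)
    next
      \<comment> \<open>Here \<open>c z = p * 2 ^ i\<close>, and \<open>2 ^ k\<close> does not
        divide it as \<open>c z \<noteq> n\<close>. Thus \<open>z\<close> is adjacent to neither
        \<open>u\<close> nor \<open>v\<close> but to \<open>h\<close>, and both distances are
        \<open>2\<close>.\<close>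
      case True
      then obtain w where w: "c z = p * w"
        by blast
      then have "w dvd 2 ^ k"
        using cz \<open>p > 1\<close> by (simp add: mult.commute[of _ p])
      then obtain i where i: "w = 2 ^ i"
        using divides_primepow_nat two_is_prime_nat by metis
      have "\<not> 2 ^ k dvd c z"
      proof
        assume "2 ^ k dvd c z"
        moreover have "coprime (2 ^ k) p"
          using \<open>odd p\<close> by simp
        ultimately have "2 ^ k dvd w"
          using w by (simp add: coprime_dvd_mult_right_iff)
        then show False
          using \<open>w dvd 2 ^ k\<close> cz w by (metis dvd_antisym mult.commute)
      qed
      moreover have "\<not> c z dvd 2 ^ k"
        using p_pk True dvd_trans by blast
      ultimately have "\<not> dvd_comparable (2 ^ k) (c z)"
        by (simp add: dvd_comparable_def)
      moreover have "dvd_comparable (2 * p) (c z)" "dvd_comparable p (c z)"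
        using w i by (cases i; auto simp: dvd_comparable_def)+
      ultimately have "(u, z) \<notin> parcs G" "(v, z) \<notin> parcs G" "(u, h) \<in> parcs G" "(v, h) \<in> parcs G"
        "(h, z) \<in> parcs G"
        using u v h zG npk by (simp_all add: arc_iff)
      then have "graph_dist G u z = 2" "graph_dist G v z = 2"
        using \<open>z \<noteq> u\<close> \<open>z \<noteq> v\<close> graph_dist_le_2 graph_dist_ge_2 by (metis antisym)+
      then show False
        using z by simp
    qed
  qed
qed

text \<open>Stated over the integers to avoid truncated subtraction;
  \<open>divisor_count_ge_2\<close> undoes the truncation in \<open>card_proper\<close>.\<close>

lemma int_card_non_reps:
  "int (card non_reps) = int n - int (totient n) - int (divisor_count n) + 1"
  using card_non_reps card_proper card_pverts divisor_count_ge_2 by linarith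

end

section \<open>Cyclic subgroups and element orders\<close>

context group
begin

text \<open>A cyclic subgroup consists of the powers of one of its elements, and powers in the
  subgroup agree with those in the group.\<close>

lemma ex_cyclic_subgroup_iff:
  assumes "a \<in> carrier G" "b \<in> carrier G"
  shows "(\<exists>C. subgroup C G \<and> cyclic_group (G\<lparr>carrier := C\<rparr>) \<and> a \<in> C \<and> b \<in> C) \<longleftrightarrow>
    (\<exists>g \<in> carrier G. a \<in> generate G {g} \<and> b \<in> generate G {g})"
proof
  assume "\<exists>C. subgroup C G \<and> cyclic_group (G\<lparr>carrier := C\<rparr>) \<and> a \<in> C \<and> b \<in> C"
  then obtain C where C: "subgroup C G" "cyclic_group (G\<lparr>carrier := C\<rparr>)" "a \<in> C" "b \<in> C"
    by blast
  interpret C: group "G\<lparr>carrier := C\<rparr>"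
    using C(1) by (rule subgroup_imp_group)
  obtain g where g: "g \<in> C" "C = range (\<lambda>k :: int. g [^]\<^bsub>G\<lparr>carrier := C\<rparr>\<^esub> k)"
    using C(2) C.cyclic_group by auto
  then have "C = range (\<lambda>k :: int. g [^] k)"
    using int_pow_consistent[OF C(1) g(1)] by simp
  moreover have "g \<in> carrier G"
    using g C(1) subgroup.subset by blast
  ultimately show "\<exists>g \<in> carrier G. a \<in> generate G {g} \<and> b \<in> generate G {g}"
    using C generate_pow by blast
next
  assume "\<exists>g \<in> carrier G. a \<in> generate G {g} \<and> b \<in> generate G {g}"
  then obtain g where g: "g \<in> carrier G" "a \<in> generate G {g}" "b \<in> generate G {g}"
    by blast
  have "subgroup (generate G {g}) G"
    using g by (intro generate_is_subgroup) auto
  moreover have "cyclic_group (G\<lparr>carrier := generate G {g}\<rparr>)"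
    using cyclic_group_generated[of g] g by (simp add: subgroup_generated_def)
  ultimately show "\<exists>C. subgroup C G \<and> cyclic_group (G\<lparr>carrier := C\<rparr>) \<and> a \<in> C \<and> b \<in> C"
    using g by blast
qed

text \<open>The exponents start at \<open>1\<close> and include \<open>ord b\<close>, which is the
  range over which \<open>card_gcd_eq_totient\<close> counts.\<close>

lemma inj_on_pow_ord:
  assumes "b \<in> carrier G"
  shows "inj_on (\<lambda>k :: nat. b [^] k) {0<..ord b}"
proof (rule inj_onI)
  fix i j
  assume *: "i \<in> {0<..ord b}" "j \<in> {0<..ord b}" "b [^] i = b [^] j"
  have "b [^] int i = b [^] int j"
    using * by (simp add: int_pow_int)
  then have "int (ord b) dvd int j - int i"
    using int_pow_eq assms by blast
  moreover have "\<bar>int j - int i\<bar> < int (ord b)"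
    using * by auto
  ultimately have "int j - int i = 0"
    using dvd_imp_le_int[of "int j - int i" "int (ord b)"] by linarith
  then show "i = j"
    by simp
qed

lemma generate_eq_pow_image:
  assumes "finite (carrier G)" "b \<in> carrier G"
  shows "generate G {b} = (\<lambda>k :: nat. b [^] k) ` {0<..ord b}"
proof (rule sym, rule card_subset_eq)
  show "finite (generate G {b})"
    using assms generate_in_carrier[of "{b}"] by (meson empty_subsetI finite_subset insert_subset subsetI)
  show "(\<lambda>k :: nat. b [^] k) ` {0<..ord b} \<subseteq> generate G {b}"
    using assms generate_pow_on_finite_carrier by blast
  show "card ((\<lambda>k :: nat. b [^] k) ` {0<..ord b}) = card (generate G {b})"
    using generate_pow_card[OF assms(2)] inj_on_pow_ord[OF assms(2)] by (metis card_greaterThanAtMost card_image diff_zero)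
qed

text \<open>With \<open>m = ord b\<close>, the power \<open>b [^] k\<close> has order
  \<open>m div gcd k m\<close>. It equals \<open>d\<close> iff \<open>gcd k m = m div d\<close>,
  which holds for \<open>totient d\<close> exponents.\<close>

lemma card_ord_in_generate:
  assumes "finite (carrier G)" "b \<in> carrier G" "d dvd ord b"
  shows "card {v \<in> generate G {b}. ord v = d} = totient d"
proof -
  define m where "m = ord b"
  have "m > 0"
    using ord_ge_1[OF assms(1,2)] by (simp add: m_def)
  have "d > 0" "m div d > 0" "m div (m div d) = d" "m div d dvd m"
    using assms(3) \<open>m > 0\<close> by (auto simp: m_def[symmetric] elim!: dvdE)
  have ord_pow': "ord (b [^] k) = d \<longleftrightarrow> gcd k m = m div d" if "k \<in> {0<..m}" for k
  proof -
    have "ord (b [^] k) = m div gcd k m"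
      using ord_pow_gen[OF assms(2), of k] that by (simp add: m_def gcd.commute)
    moreover have "m div g = d \<longleftrightarrow> g = m div d" if "g dvd m" for g
      using that assms(3) \<open>m > 0\<close> by (auto simp: m_def[symmetric] elim!: dvdE)
    ultimately show ?thesis
      by simp
  qed
  have "{v \<in> generate G {b}. ord v = d} = (\<lambda>k :: nat. b [^] k) ` {k \<in> {0<..m}. gcd k m = m div d}"
    unfolding generate_eq_pow_image[OF assms(1,2)] Compr_image_eq m_def[symmetric]
    using ord_pow' by (intro arg_cong[where f = "image _"] Collect_cong) blast
  moreover have "inj_on (\<lambda>k :: nat. b [^] k) {k \<in> {0<..m}. gcd k m = m div d}"
    using inj_on_pow_ord[OF assms(2)] by (rule inj_on_subset) (auto simp: m_def)
  ultimately show ?thesis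
    using card_gcd_eq_totient[OF \<open>m > 0\<close> \<open>m div d dvd m\<close>] \<open>m div (m div d) = d\<close>
    by (simp add: card_image)
qed

lemma generate_mono_singleton:
  assumes "b \<in> carrier G" "a \<in> generate G {b}"
  shows "generate G {a} \<subseteq> generate G {b}"
  using assms by (intro generate_subgroup_incl generate_is_subgroup) auto

lemma ord_dvd_of_mem_generate:
  assumes "finite (carrier G)" "b \<in> carrier G" "a \<in> generate G {b}"
  shows "ord a dvd ord b"
proof -
  obtain k :: nat where k: "a = b [^] k"
    using assms generate_pow_on_finite_carrier by blast
  have "a [^] ord b = \<one>"
    unfolding k using assms(2) by (simp add: nat_pow_pow pow_eq_id)
  then show ?thesis
    using k assms(2) pow_eq_id by simp
qed

text \<open>
  Inside a cyclic group the subgroup \<open>\<langle>b\<rangle>\<close> already contains the \<open>\<phi>(d)\<close> elements of each order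
  \<open>d\<close> dividing the order of \<open>b\<close>.
\<close>

lemma mem_generate_iff_ord_dvd:
  assumes fin: "finite (carrier G)" and g: "g \<in> carrier G"
    and a: "a \<in> generate G {g}" and b: "b \<in> generate G {g}"
  shows "a \<in> generate G {b} \<longleftrightarrow> ord a dvd ord b"
proof
  have bG: "b \<in> carrier G"
    using b g generate_in_carrier[of "{g}"] by blast
  show "ord a dvd ord b" if "a \<in> generate G {b}"
    using ord_dvd_of_mem_generate[OF fin bG that] .
  show "a \<in> generate G {b}" if dvd: "ord a dvd ord b"
  proof -
    have "finite (generate G {g})"
      using fin g generate_incl[of "{g}"] by (auto intro: finite_subset)
    then have "{v \<in> generate G {b}. ord v = ord a} = {v \<in> generate G {g}. ord v = ord a}"
      using generate_mono_singleton[OF g b] card_ord_in_generate[OF fin bG dvd]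
        card_ord_in_generate[OF fin g ord_dvd_of_mem_generate[OF fin g a]]
      by (intro card_subset_eq) auto
    then show ?thesis
      using a by blast
  qed
qed

text \<open>The Chinese remainder isomorphism, sending \<open>(i, j)\<close> to \<open>x ^ (i * b + j * a)\<close>.\<close>

lemma subgroup_generated_iso_coprime:
  assumes x: "x \<in> carrier G" and ord: "ord x = a * b" and ab: "coprime a b" "a > 0" "b > 0"
  shows "subgroup_generated G {x} \<cong> integer_mod_group a \<times>\<times> integer_mod_group b"
proof -
  define h where "h = (\<lambda>(i, j). x [^] (i * int b + j * int a))"
  let ?P = "integer_mod_group a \<times>\<times> integer_mod_group b"
  let ?S = "subgroup_generated G {x}"
  have pow_eq: "x [^] s = x [^] t \<longleftrightarrow> int a * int b dvd t - s" for s t :: int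
    using int_pow_eq[OF x] ord by simp
  have carS: "carrier ?S = range (\<lambda>k :: int. x [^] k)"
    using x by (rule carrier_subgroup_generated_by_singleton)
  have carP: "carrier ?P = {0..<int a} \<times> {0..<int b}"
    using ab by (simp add: carrier_integer_mod_group)
  have hom: "h \<in> hom ?P ?S"
  proof (rule homI)
    show "h u \<in> carrier ?S" for u
      by (auto simp: carS h_def split: prod.split)
  next
    fix u v :: "int \<times> int"
    obtain i j i' j' where uv: "u = (i, j)" "v = (i', j')"
      by (cases u, cases v) auto
    \<comment> \<open>Reducing \<open>i + i'\<close> modulo \<open>a\<close> changes
      \<open>(i + i') * b\<close> by a multiple of \<open>a * b\<close>, and likewise for the second
      coordinate.\<close>
    have "int a * int b dvd ((i * int b + j * int a) + (i' * int b + j' * int a)) -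
        ((i + i') mod int a * int b + (j + j') mod int b * int a)"
    proof -
      have "((i * int b + j * int a) + (i' * int b + j' * int a)) -
        ((i + i') mod int a * int b + (j + j') mod int b * int a) =
        int a * int b * ((i + i') div int a + (j + j') div int b)"
        by (simp add: minus_mod_eq_mult_div[symmetric] algebra_simps)
           (simp add: minus_div_mult_eq_mod[symmetric] algebra_simps)
      then show ?thesis
        by simp
    qed
    then have "x [^] ((i + i') mod int a * int b + (j + j') mod int b * int a) =
        x [^] ((i * int b + j * int a) + (i' * int b + j' * int a))"
      by (simp add: pow_eq)
    also have "\<dots> = x [^] (i * int b + j * int a) \<otimes> x [^] (i' * int b + j' * int a)"
      using x by (simp add: int_pow_mult)
    finally show "h (u \<otimes>\<^bsub>?P\<^esub> v) = h u \<otimes>\<^bsub>?S\<^esub> h v"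
      by (simp add: uv h_def)
  qed
  have inj: "inj_on h (carrier ?P)"
  proof (rule inj_onI)
    fix u v
    assume *: "u \<in> carrier ?P" "v \<in> carrier ?P" "h u = h v"
    obtain i j i' j' where uv: "u = (i, j)" "v = (i', j')"
      by (cases u, cases v) auto
    have d: "int a * int b dvd (i' - i) * int b + (j' - j) * int a"
      using * by (simp add: uv h_def pow_eq algebra_simps)
    \<comment> \<open>Modulo \<open>a\<close> only the term with \<open>b\<close> survives, and
      conversely; coprimality then cancels the factor.\<close>
    then have "int a dvd (i' - i) * int b" "int b dvd (j' - j) * int a"
      by (metis dvd_add_left_iff dvd_mult_left dvd_triv_right)
         (metis d dvd_add_right_iff dvd_mult_right dvd_triv_right)
    then have "int a dvd i' - i" "int b dvd j' - j"
      using ab(1) by (simp_all add: coprime_dvd_mult_left_iff coprime_commute)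
    moreover have "\<bar>i' - i\<bar> < int a" "\<bar>j' - j\<bar> < int b"
      using *(1,2) unfolding carP uv by auto
    ultimately have "i' - i = 0" "j' - j = 0"
      using dvd_imp_le_int[of "i' - i" "int a"] dvd_imp_le_int[of "j' - j" "int b"] by linarith+
    then show "u = v"
      by (simp add: uv)
  qed
  have "card (carrier ?S) = a * b"
    using generate_pow_card[OF x] ord x by (simp add: carrier_subgroup_generated)
  moreover have "card (carrier ?P) = a * b"
    unfolding carP by simp
  moreover have "finite (carrier ?S)"
    using calculation(1) ab by (metis card.infinite mult_eq_0_iff neq0_conv)
  \<comment> \<open>An injection between finite sets of the same size is onto.\<close>
  ultimately have "h ` carrier ?P = carrier ?S"
    using hom inj by (intro card_subset_eq) (auto simp: card_image hom_def)
  then have "h \<in> iso ?P ?S"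
    using hom inj by (simp add: iso_def bij_betw_def)
  then have "?P \<cong> ?S"
    unfolding is_iso_def by blast
  then show ?thesis
    using group.iso_sym[OF DirProd_group[OF group_integer_mod_group group_integer_mod_group]] by blast
qed

text \<open>One direction compares cardinalities, the other is the Chinese remainder theorem. This
  turns the isomorphism condition into an equation for \<open>n\<close>.\<close>

lemma subgroup_generated_iso_iff:
  assumes x: "x \<in> carrier G" and "coprime a b" "a > 0" "b > 0"
  shows "subgroup_generated G {x} \<cong> integer_mod_group a \<times>\<times> integer_mod_group b \<longleftrightarrow> ord x = a * b"
proof
  assume "subgroup_generated G {x} \<cong> integer_mod_group a \<times>\<times> integer_mod_group b"
  then have "card (carrier (subgroup_generated G {x})) =
      card (carrier (integer_mod_group a \<times>\<times> integer_mod_group b))"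
    by (rule iso_same_card)
  then show "ord x = a * b"
    using generate_pow_card[OF x] x assms
    by (simp add: carrier_subgroup_generated carrier_integer_mod_group)
qed (use assms in \<open>simp add: subgroup_generated_iso_coprime\<close>)

end

section \<open>The difference graph of a dihedral group\<close>

locale dihedral = group G for G (structure) +
  fixes n :: nat and x y :: 'a
  assumes is_dihedral: "is_dihedral G n x y" and n_pos: "n > 0"
begin

lemma x_carrier [simp]: "x \<in> carrier G" and y_carrier [simp]: "y \<in> carrier G"
  and generated: "generate G {x, y} = carrier G"
  and card_carrier: "card (carrier G) = 2 * n"
  and y_y: "y \<otimes> y = \<one>"
  and xy: "x \<otimes> y = y \<otimes> inv x"
  and x_pow_n: "x [^] n = \<one>"
  using is_dihedral by (auto simp: is_dihedral_def order_def numeral_2_eq_2)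

lemma finite_carrier: "finite (carrier G)"
  using card_carrier n_pos by (intro card_ge_0_finite) simp

section \<open>Rotations, reflections and the order of \<open>x\<close>\<close>

definition rotations :: "'a set" where
  "rotations = generate G {x}"

lemma rotations_subgroup: "subgroup rotations G"
  unfolding rotations_def by (rule generate_is_subgroup) simp

lemma rotations_carrier: "r \<in> rotations \<Longrightarrow> r \<in> carrier G"
  using rotations_subgroup subgroup.mem_carrier by metis

lemma rotations_mult: "r \<in> rotations \<Longrightarrow> s \<in> rotations \<Longrightarrow> r \<otimes> s \<in> rotations"
  using rotations_subgroup subgroup.m_closed by metis

lemma rotations_inv: "r \<in> rotations \<Longrightarrow> inv r \<in> rotations"
  using rotations_subgroup subgroup.m_inv_closed by metis

lemma y_x: "y \<otimes> x = inv x \<otimes> y"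
proof -
  have "x \<otimes> (y \<otimes> x) = y"
    using xy by (simp add: m_assoc flip: m_assoc[of x])
  then have "inv x \<otimes> y = inv x \<otimes> (x \<otimes> (y \<otimes> x))"
    by simp
  then show ?thesis
    by (simp flip: m_assoc)
qed

lemma y_pow_x: "y \<otimes> x [^] (k :: nat) = inv (x [^] k) \<otimes> y"
proof (induction k)
  case (Suc k)
  have "y \<otimes> x [^] Suc k = (y \<otimes> x [^] k) \<otimes> x"
    by (simp add: m_assoc)
  also have "\<dots> = inv (x [^] k) \<otimes> (y \<otimes> x)"
    by (simp add: Suc m_assoc)
  also have "\<dots> = inv (x [^] k) \<otimes> inv x \<otimes> y"
    by (simp add: y_x m_assoc)
  also have "inv (x [^] k) \<otimes> inv x = inv (x [^] Suc k)"
    by (metis inv_mult_group nat_pow_Suc2 nat_pow_closed x_carrier)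
  finally show ?case .
qed simp

lemma y_rotation:
  assumes "r \<in> rotations"
  shows "y \<otimes> r = inv r \<otimes> y"
proof -
  obtain k :: nat where "r = x [^] k"
    using assms generate_pow_on_finite_carrier[OF finite_carrier x_carrier]
    by (auto simp: rotations_def)
  then show ?thesis
    by (simp add: y_pow_x)
qed

text \<open>The rotations together with their coset by \<open>y\<close> contain the generators and
  their inverses and are closed under products.\<close>

lemma carrier_cases:
  assumes "g \<in> carrier G"
  shows "g \<in> rotations \<or> (\<exists>r \<in> rotations. g = r \<otimes> y)"
proof -
  have one_rot: "\<one> \<in> rotations"
    using rotations_subgroup subgroup.one_closed by metis
  have x_rot: "x \<in> rotations"
    unfolding rotations_def by (rule generate.incl) simp
  have inv_y: "inv y = y"
    using y_y by (simp add: inv_equality)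
  have "g \<in> generate G {x, y}"
    using assms generated by simp
  then show ?thesis
  proof (induction rule: generate.induct)
    case one
    then show ?case
      using one_rot by simp
  next
    case (incl h)
    then show ?case
      using one_rot x_rot by force
  next
    case (inv h)
    then show ?case
      using one_rot x_rot rotations_inv inv_y by force
  next
    case (eng h1 h2)
    have "r \<otimes> y \<otimes> s = (r \<otimes> inv s) \<otimes> y" "r \<otimes> y \<otimes> (s \<otimes> y) = r \<otimes> inv s" "r \<otimes> (s \<otimes> y) = (r \<otimes> s) \<otimes> y"
      if "r \<in> rotations" "s \<in> rotations" for r s
    proof -
      have [simp]: "r \<in> carrier G" "s \<in> carrier G"
        using that rotations_carrier by auto
      show *: "r \<otimes> y \<otimes> s = (r \<otimes> inv s) \<otimes> y"
        using y_rotation[OF that(2)] by (simp add: m_assoc)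
      show "r \<otimes> (s \<otimes> y) = (r \<otimes> s) \<otimes> y"
        by (simp add: m_assoc)
      have "r \<otimes> y \<otimes> (s \<otimes> y) = (r \<otimes> inv s) \<otimes> y \<otimes> y"
        by (simp flip: * m_assoc)
      then show "r \<otimes> y \<otimes> (s \<otimes> y) = r \<otimes> inv s"
        using y_y by (simp add: m_assoc)
    qed
    then show ?case
      using eng.IH rotations_mult rotations_inv by metis
  qed
qed

text \<open>The relations give only \<open>ord x dvd n\<close>. Equality comes from the group order:
  two sets of at most \<open>ord x\<close> elements cover all \<open>2 * n\<close>.\<close>

lemma ord_x: "ord x = n"
proof -
  have card_rot: "card rotations = ord x"
    unfolding rotations_def using generate_pow_card by simp
  have fin: "finite rotations"
    using finite_carrier rotations_carrier by (meson finite_subset subsetI)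
  have "carrier G \<subseteq> rotations \<union> (\<lambda>r. r \<otimes> y) ` rotations"
    using carrier_cases by blast
  then have "2 * n \<le> card (rotations \<union> (\<lambda>r. r \<otimes> y) ` rotations)"
    using fin card_carrier by (metis card_mono finite_UnI finite_imageI)
  also have "\<dots> \<le> ord x + ord x"
    using card_Un_le[of rotations "(\<lambda>r. r \<otimes> y) ` rotations"]
      card_image_le[OF fin, of "\<lambda>r. r \<otimes> y"] card_rot by linarith
  finally have "n \<le> ord x"
    by simp
  moreover have "ord x dvd n"
    using x_pow_n by (simp add: pow_eq_id)
  ultimately show ?thesis
    using n_pos by (simp add: dvd_imp_le le_antisym)
qed

lemma reflection_square:
  assumes "g \<in> carrier G" "g \<notin> rotations"
  shows "g \<otimes> g = \<one>"
proof -
  obtain r where r: "r \<in> rotations" "g = r \<otimes> y"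
    using assms carrier_cases by blast
  then have [simp]: "r \<in> carrier G"
    using rotations_carrier by simp
  have "g \<otimes> g = r \<otimes> (y \<otimes> r) \<otimes> y"
    by (simp add: r m_assoc)
  also have "\<dots> = \<one>"
    using y_rotation[OF r(1)] y_y by (simp add: m_assoc flip: m_assoc[of r "inv r"])
  finally show ?thesis .
qed

text \<open>Since \<open>a\<close> is no rotation, neither is \<open>g\<close>. Then
  \<open>g\<close> squares to \<open>\<one>\<close>, so its powers are \<open>g\<close> and the
  rotation \<open>\<one>\<close>.\<close>

lemma reflection_mem_generate:
  assumes "g \<in> carrier G" "a \<in> generate G {g}" "a \<notin> rotations"
  shows "a = g"
proof -
  have "g \<notin> rotations"
  proof
    assume "g \<in> rotations"
    then have "generate G {g} \<subseteq> rotations"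
      unfolding rotations_def by (intro generate_mono_singleton) simp_all
    then show False
      using assms by blast
  qed
  then have "g [^] (2 :: nat) = \<one>"
    using assms reflection_square by (simp add: numeral_2_eq_2)
  then have "ord g dvd 2"
    using assms(1) pow_eq_id by blast
  then have le: "ord g \<le> 2"
    by (simp add: dvd_imp_le)
  have one: "\<one> \<in> rotations"
    using rotations_subgroup subgroup.one_closed by metis
  obtain k :: nat where k: "a = g [^] k" "0 < k" "k \<le> ord g"
    using assms generate_eq_pow_image[OF finite_carrier assms(1)] by auto
  have "k \<noteq> 2"
    using k \<open>g [^] (2 :: nat) = \<one>\<close> one assms by metis
  then have "k = 1"
    using k le by linarith
  then show ?thesis
    using k assms by simp
qed

text \<open>Two rotations always share the cyclic group of \<open>x\<close>, so only the power graph
  restricts their adjacency, and inside this group membership is divisibility of orders.\<close>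

lemma difference_graph_arc_iff:
  "(a, b) \<in> parcs (difference_graph G) \<longleftrightarrow>
    a \<in> rotations \<and> b \<in> rotations \<and> \<not> dvd_comparable (ord a) (ord b)"
proof -
  have "(a, b) \<in> parcs (difference_graph G) \<longleftrightarrow>
      a \<in> carrier G \<and> b \<in> carrier G \<and> a \<noteq> b \<and>
      (\<exists>g \<in> carrier G. a \<in> generate G {g} \<and> b \<in> generate G {g}) \<and>
      a \<notin> generate G {b} \<and> b \<notin> generate G {a}"
    using ex_cyclic_subgroup_iff[of a b]
    by (auto simp: difference_graph_def delete_isolated_def enhanced_power_graph_def
        power_graph_def)
  also have "\<dots> \<longleftrightarrow> a \<in> rotations \<and> b \<in> rotations \<and> a \<notin> generate G {b} \<and> b \<notin> generate G {a}"
  proof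
    assume *: "a \<in> carrier G \<and> b \<in> carrier G \<and> a \<noteq> b \<and>
      (\<exists>g \<in> carrier G. a \<in> generate G {g} \<and> b \<in> generate G {g}) \<and>
      a \<notin> generate G {b} \<and> b \<notin> generate G {a}"
    then obtain g where "g \<in> carrier G" "a \<in> generate G {g}" "b \<in> generate G {g}"
      by blast
    \<comment> \<open>If \<open>a\<close> were a reflection it would equal \<open>g\<close>, and
      \<open>b\<close> would be one of its powers, contrary to the removal of power graph edges;
      symmetrically for \<open>b\<close>.\<close>
    then have "a \<in> rotations" "b \<in> rotations"
      using * reflection_mem_generate by blast+
    then show "a \<in> rotations \<and> b \<in> rotations \<and> a \<notin> generate G {b} \<and> b \<notin> generate G {a}"
      using * by blast
  next
    assume *: "a \<in> rotations \<and> b \<in> rotations \<and> a \<notin> generate G {b} \<and> b \<notin> generate G {a}"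
    moreover have "a \<noteq> b"
      using * generate.incl[of a "{a}" G] by blast
    ultimately show "a \<in> carrier G \<and> b \<in> carrier G \<and> a \<noteq> b \<and>
      (\<exists>g \<in> carrier G. a \<in> generate G {g} \<and> b \<in> generate G {g}) \<and>
      a \<notin> generate G {b} \<and> b \<notin> generate G {a}"
      using rotations_carrier x_carrier unfolding rotations_def by blast
  qed
  also have "\<dots> \<longleftrightarrow> a \<in> rotations \<and> b \<in> rotations \<and> \<not> dvd_comparable (ord a) (ord b)"
    using mem_generate_iff_ord_dvd[OF finite_carrier x_carrier, of a b]
      mem_generate_iff_ord_dvd[OF finite_carrier x_carrier, of b a]
    by (auto simp: dvd_comparable_def rotations_def)
  finally show ?thesis .
qed

section \<open>Orders of rotations and the vertex set\<close>

lemma ord_rotation_dvd: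
  assumes "r \<in> rotations"
  shows "ord r dvd n"
  using ord_dvd_of_mem_generate[OF finite_carrier x_carrier, of r] assms ord_x
  by (simp add: rotations_def)

lemma not_prime_power:
  assumes "pverts (difference_graph G) \<noteq> {}"
  shows "\<nexists>p k. prime p \<and> n = p ^ k"
proof
  assume "\<exists>p k. prime p \<and> n = p ^ k"
  then have "dvd_comparable a b" if "a dvd n" "b dvd n" for a b
    using that dvd_comparable_prime_power by blast
  moreover obtain a b where "(a, b) \<in> parcs (difference_graph G)"
    using assms by (auto simp: difference_graph_def delete_isolated_def)
  ultimately show False
    using difference_graph_arc_iff ord_rotation_dvd by blast
qed

text \<open>A rotation of order other than \<open>1\<close> and \<open>n\<close> has a neighbour:
  some divisor of \<open>n\<close> is incomparable with its order, and every divisor is the order of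
  a rotation.\<close>

lemma pverts_difference_graph:
  assumes "\<nexists>p k. prime p \<and> n = p ^ k"
  shows "pverts (difference_graph G) = {r \<in> rotations. ord r \<in> proper_divisors n}"
proof -
  have "a \<in> pverts (difference_graph G) \<longleftrightarrow> (\<exists>b. (a, b) \<in> parcs (difference_graph G))" for a
    using rotations_carrier difference_graph_arc_iff[of a]
    by (auto simp: difference_graph_def delete_isolated_def)
  moreover have "(\<exists>b. (r, b) \<in> parcs (difference_graph G)) \<longleftrightarrow> ord r \<in> proper_divisors n"
    if r: "r \<in> rotations" for r
  proof
    assume "\<exists>b. (r, b) \<in> parcs (difference_graph G)"
    then obtain b where b: "b \<in> rotations" "\<not> dvd_comparable (ord r) (ord b)"
      using difference_graph_arc_iff by blast
    then show "ord r \<in> proper_divisors n"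
      using ord_rotation_dvd[OF r] ord_rotation_dvd[OF b(1)]
      by (auto simp: proper_divisors_def dvd_comparable_def)
  next
    assume "ord r \<in> proper_divisors n"
    then obtain d where d: "d dvd n" "\<not> dvd_comparable (ord r) d"
      using exists_incomparable_divisor[of "ord r" n] assms n_pos
      by (auto simp: proper_divisors_def)
    then have "d > 0"
      using n_pos by (auto intro!: Nat.gr0I)
    then have "card {v \<in> rotations. ord v = d} > 0"
      using card_ord_in_generate[OF finite_carrier x_carrier, of d] d ord_x
      by (simp add: rotations_def)
    then obtain b where "b \<in> rotations" "ord b = d"
      by (metis (mono_tags, lifting) card.empty empty_Collect_eq less_irrefl)
    then show "\<exists>b. (r, b) \<in> parcs (difference_graph G)"
      using d r difference_graph_arc_iff by blast
  qed
  ultimately show ?thesis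
    using difference_graph_arc_iff by blast
qed

lemma divisor_graph_difference_graph:
  assumes "\<nexists>p k. prime p \<and> n = p ^ k"
  shows "divisor_graph (difference_graph G) n ord"
proof -
  interpret pair_graph "difference_graph G"
    using finite_carrier by (rule pair_graph_difference_graph)
  show ?thesis
  proof
    show "card {v \<in> pverts (difference_graph G). ord v = d} = totient d"
      if "d \<in> proper_divisors n" for d
    proof -
      have "{v \<in> pverts (difference_graph G). ord v = d} = {v \<in> generate G {x}. ord v = d}"
        using that by (auto simp: pverts_difference_graph[OF assms] rotations_def)
      then show ?thesis
        using card_ord_in_generate[OF finite_carrier x_carrier, of d] that ord_x
        by (simp add: proper_divisors_def)
    qed
    show "(u, v) \<in> parcs (difference_graph G) \<longleftrightarrow> u \<in> pverts (difference_graph G) \<and>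
        v \<in> pverts (difference_graph G) \<and> \<not> dvd_comparable (ord u) (ord v)" for u v
      using difference_graph_arc_iff pverts_difference_graph[OF assms] arc_fst_in_verts
        arc_snd_in_verts by fastforce
  qed (use assms n_pos pverts_difference_graph in auto)
qed

end

theorem theorem2p10:
  fixes G :: "('a, 'b) monoid_scheme" and n :: nat and x y :: 'a
  assumes "n \<ge> 3"
    and "is_dihedral G n x y"
    and "pverts (difference_graph G) \<noteq> {}"
  shows "((\<exists>k p. 1 < k \<and> prime p \<and> p \<noteq> 2 \<and>
             subgroup_generated G {x} \<cong> integer_mod_group (2 ^ k) \<times>\<times> integer_mod_group p) \<longrightarrow>
           int (metric_dimension (difference_graph G)) =
             int n - int (totient n) - int (divisor_count n) + 2) \<and>
         (\<not> (\<exists>k p. 1 < k \<and> prime p \<and> p \<noteq> 2 \<and>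
             subgroup_generated G {x} \<cong> integer_mod_group (2 ^ k) \<times>\<times> integer_mod_group p) \<longrightarrow>
           int (metric_dimension (difference_graph G)) =
             int n - int (totient n) - int (divisor_count n) + 1)"
proof -
  interpret dihedral G n x y
    using assms(1,2) by (intro dihedral.intro dihedral_axioms.intro) (simp_all add: is_dihedral_def)
  interpret difference: divisor_graph "difference_graph G" n ord
    using assms(3) by (intro divisor_graph_difference_graph not_prime_power)
  \<comment> \<open>Both cases of the theorem thereby become conditions on \<open>n\<close>
    alone.\<close>
  have iso_iff: "subgroup_generated G {x} \<cong> integer_mod_group (2 ^ k) \<times>\<times> integer_mod_group p \<longleftrightarrow>
      n = 2 ^ k * p" if "prime p" "p \<noteq> 2" for k p
  proof -
    have "coprime (2 ^ k) p"
      using that primes_coprime[of 2 p] by simp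
    then show ?thesis
      using subgroup_generated_iso_iff[of x "2 ^ k" p] that ord_x prime_gt_0_nat by auto
  qed
  show ?thesis
  proof (intro conjI impI)
    assume "\<exists>k p. 1 < k \<and> prime p \<and> p \<noteq> 2 \<and>
      subgroup_generated G {x} \<cong> integer_mod_group (2 ^ k) \<times>\<times> integer_mod_group p"
    then obtain k p where "1 < k" "prime p" "p \<noteq> 2" "n = 2 ^ k * p"
      using iso_iff by blast
    then have "metric_dimension (difference_graph G) = card difference.non_reps + 1"
      by (rule difference.metric_dimension_exceptional)
    then show "int (metric_dimension (difference_graph G)) =
        int n - int (totient n) - int (divisor_count n) + 2"
      using difference.int_card_non_reps by simp
  next
    assume "\<nexists>k p. 1 < k \<and> prime p \<and> p \<noteq> 2 \<and>
      subgroup_generated G {x} \<cong> integer_mod_group (2 ^ k) \<times>\<times> integer_mod_group p"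
    then have "\<nexists>k p. 1 < k \<and> prime p \<and> p \<noteq> 2 \<and> n = 2 ^ k * p"
      using iso_iff by blast
    then have "metric_dimension (difference_graph G) = card difference.non_reps"
      by (rule difference.metric_dimension_generic)
    then show "int (metric_dimension (difference_graph G)) =
        int n - int (totient n) - int (divisor_count n) + 1"
      using difference.int_card_non_reps by simp
  qed
qed

end
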